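(* Let $F\in\mathcal F_1(I)$ be strictly increasing with $\max F(x)<x$ for all $x\in(a,b)$ and $\max F(b)\le b$. Let $c_i\in J(F)$ satisfy $J(F)\cap F(c_i)=\{c_i\}$ and suppose the set $F(c_i)$ is a compact interval. Let $n\ge 1$ be an integer and let $f_*$ be a map on $I\setminus J(F)$ of the form described in the context. Then the multifunction $$f(x):=\begin{cases} f_*(x), & x\in I\setminus J(F),\\ \left[\lim_{s\to c_i-}f_*(s),\,c_i\right], & x=c_i,\end{cases}$$ is a strictly increasing usc iterative root of $F$ of order $n$ on $(I\setminus J(F))\cup\{c_i\}$.
   Context: Let $I=[a,b]\subset\mathbb R$, $a<b$. A multifunction $F:I\to 2^I$ assigns to each $x\in I$ a nonempty subset $F(x)\subset I$ (singletons are identified with their elements); $F(A)=\bigcup_{x\in A}F(x)$, $(G\circ F)(x)=G(F(x))$, $F^0(x)=\{x\}$, $F^n=F\circ F^{n-1}$. $F$ is upper semi-continuous (usc) at $x_0$ if for every open $V\subset\mathbb R$ with $F(x_0)\subset V$ there is a neighborhood $U$ of $x_0$ such that $F(x)\subset V$ for all $x\in U$ in the domain; usc means usc at every point. $F$ is strictly increasing (resp. strictly decreasing) if $\max F(x)<\min F(y)$ (resp. $\min F(x)>\max F(y)$) whenever $x<y$ in the domain; strictly monotone means one of these. $\mathcal F(I)$ is the class of strictly monotone usc multifunctions $I\to 2^I$. A jump of $F$ is a point $x_0\in I$ with $\#F(x_0)\ge 2$; $J(F)$ is the set of jumps. For $F\in\mathcal F(I)$ with finitely many jumps, the intensity $\zeta(F)$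 is the least integer $k\ge 0$ with $\#J(F^k)=\#J(F^{k+1})$ (and $+\infty$ if there is none). $\mathcal F_1(I)$ is the set of $F\in\mathcal F(I)$ with finitely many jumps and $\zeta(F)=1$. For $F\in\mathcal F_1(I)$ as in the claim write $J(F)=\{c_1,\dots,c_m\}$ with $a=:c_0<c_1<\dots<c_m\le c_{m+1}:=b$ (a jump at the right endpoint $b$ is allowed), put $I_i:=(c_i,c_{i+1})$ and let $I(F)$ be the set of the nonempty intervals among $I_0,\dots,I_m$; $F$ is single-valued and continuous on each of them and maps $I\setminus J(F)$ into itself. Under the hypotheses on $F$ in the claim, $K=(a,c_1)$ is the unique $J\in I(F)$ with $F(J)\subset J$ (the absorbing interval). For $D\subset I$, an iterative root of $F$ of order $n$ on $D$ is a (multi)function $f$ from $D$ to nonempty subsets of $D$ with $f^n(x)=F(x)$ for all $x\in D$. The map $f_*$: $f_*:I\setminus J(F)\to I\setminus J(F)$ is a single-valued continuous strictly increasing iterative root of order $n$ of $F$ on $I\setminus J(F)$ obtained by extending an increasing iterative root $\phi$ of order $n$ of $F|_K$ on $K$: $f_*=\phi$ on $K$, and for each $I_j\in I(F)\setminus\{K\}$, $f_*=F|_{I_{j_1}}^{-1}\circ f_*\circ F|_{I_j}$ on $I_j$, where $I_{j_1}\in I(F)$ is the interval containing $f_*(I_j)$ (when $F(I_j)\subset K$ the middle factor is $\phi$). *)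

theory Defs
  imports "HOL-Analysis.Analysis" "HOL-Library.Extended_Nat"
begin

text \<open>
  Multifunctions are total functions into sets; only their values on the relevant domain matter.
\<close>

definition multifunction_on :: "'a set \<Rightarrow> ('a \<Rightarrow> 'a set) \<Rightarrow> bool" where
  "multifunction_on D F \<longleftrightarrow> (\<forall>x\<in>D. F x \<noteq> {} \<and> F x \<subseteq> D)"

definition mimage :: "('a \<Rightarrow> 'b set) \<Rightarrow> 'a set \<Rightarrow> 'b set" where
  "mimage F A = (\<Union>x\<in>A. F x)"

definition mcomp :: "('b \<Rightarrow> 'c set) \<Rightarrow> ('a \<Rightarrow> 'b set) \<Rightarrow> 'a \<Rightarrow> 'c set" where
  "mcomp G F = (\<lambda>x. mimage G (F x))"

primrec miter :: "nat \<Rightarrow> ('a \<Rightarrow> 'a set) \<Rightarrow> 'a \<Rightarrow> 'a set" where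
  "miter 0 F = (\<lambda>x. {x})"
| "miter (Suc n) F = mcomp F (miter n F)"

definition usc_on :: "real set \<Rightarrow> (real \<Rightarrow> real set) \<Rightarrow> bool" where
  "usc_on D F \<longleftrightarrow>
     (\<forall>x0\<in>D. \<forall>V. open V \<and> F x0 \<subseteq> V \<longrightarrow>
        (\<exists>U. open U \<and> x0 \<in> U \<and> (\<forall>x\<in>U \<inter> D. F x \<subseteq> V)))"

definition has_extrema :: "real set \<Rightarrow> bool" where
  "has_extrema S \<longleftrightarrow> (\<exists>M\<in>S. \<forall>y\<in>S. y \<le> M) \<and> (\<exists>m\<in>S. \<forall>y\<in>S. m \<le> y)"

text \<open>
  The values of a multifunction need not be closed, so the existence of the maxima and minima used
  to express strict monotonicity is part of that notion. Where they exist, they are the supremum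
  and the infimum (the library's Max and Min are for finite sets only).
\<close>

definition strictly_increasing_on :: "real set \<Rightarrow> (real \<Rightarrow> real set) \<Rightarrow> bool" where
  "strictly_increasing_on D F \<longleftrightarrow>
     (\<forall>x\<in>D. has_extrema (F x)) \<and> (\<forall>x\<in>D. \<forall>y\<in>D. x < y \<longrightarrow> Sup (F x) < Inf (F y))"

definition strictly_decreasing_on :: "real set \<Rightarrow> (real \<Rightarrow> real set) \<Rightarrow> bool" where
  "strictly_decreasing_on D F \<longleftrightarrow>
     (\<forall>x\<in>D. has_extrema (F x)) \<and> (\<forall>x\<in>D. \<forall>y\<in>D. x < y \<longrightarrow> Inf (F x) > Sup (F y))"

definition strictly_monotone_usc :: "real set \<Rightarrow> (real \<Rightarrow> real set) set" where
  "strictly_monotone_usc I =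
     {F. multifunction_on I F \<and> usc_on I F \<and>
         (strictly_increasing_on I F \<or> strictly_decreasing_on I F)}"

definition jumps :: "real set \<Rightarrow> (real \<Rightarrow> real set) \<Rightarrow> real set" where
  "jumps I F = {x\<in>I. \<exists>u\<in>F x. \<exists>v\<in>F x. u \<noteq> v}"

text \<open>
  Only meant for strictly monotone \<open>F\<close> with finitely many jumps; then all iterates have finitely
  many jumps and \<open>card\<close> is the true cardinality.
\<close>

definition intensity :: "real set \<Rightarrow> (real \<Rightarrow> real set) \<Rightarrow> enat" where
  "intensity I F =
     (if \<exists>k. card (jumps I (miter k F)) = card (jumps I (miter (Suc k) F))
      then enat (LEAST k. card (jumps I (miter k F)) = card (jumps I (miter (Suc k) F)))
      else \<infinity>)"

definition intensity_one :: "real set \<Rightarrow> (real \<Rightarrow> real set) set" where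
  "intensity_one I =
     {F \<in> strictly_monotone_usc I. finite (jumps I F) \<and> intensity I F = 1}"

text \<open>
  The nonempty intervals between consecutive points of \<open>c\<^sub>0 = a < c\<^sub>1 < \<dots> < c\<^sub>m \<le> c\<^sub>m\<^sub>+\<^sub>1 = b\<close>, where
  \<open>c\<^sub>1, \<dots>, c\<^sub>m\<close> are the jumps.
\<close>

definition jump_intervals :: "real \<Rightarrow> real \<Rightarrow> (real \<Rightarrow> real set) \<Rightarrow> real set set" where
  "jump_intervals a b F =
     {{u<..<v} | u v. u \<in> insert a (jumps {a..b} F) \<and> v \<in> insert b (jumps {a..b} F) \<and>
                      u < v \<and> {u<..<v} \<inter> jumps {a..b} F = {}}"

text \<open>
  The interval \<open>(a, c\<^sub>1)\<close>. For strictly increasing \<open>F\<close> of intensity one lying below the diagonal on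
  \<open>(a, b)\<close> it is the only jump interval that \<open>F\<close> maps into itself.
\<close>

definition absorbing_interval :: "real \<Rightarrow> real \<Rightarrow> (real \<Rightarrow> real set) \<Rightarrow> real set" where
  "absorbing_interval a b F = {a<..<Min (jumps {a..b} F)}"

definition iterative_root_on ::
    "'a set \<Rightarrow> nat \<Rightarrow> ('a \<Rightarrow> 'a set) \<Rightarrow> ('a \<Rightarrow> 'a set) \<Rightarrow> bool" where
  "iterative_root_on D n F f \<longleftrightarrow> multifunction_on D f \<and> (\<forall>x\<in>D. miter n f x = F x)"

text \<open>
  \<open>fs\<close> extends an increasing root \<open>\<phi>\<close> on the absorbing interval to the complement of the jumps.
  Away from the jumps \<open>F\<close> is single-valued, with value \<open>the_elem (F x)\<close> at \<open>x\<close>. The condition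
  \<open>fs (g x) \<in> g ` J1\<close> below says that the inverse of the restriction of \<open>g\<close> to \<open>J1\<close> is
  applied inside its domain.
\<close>

definition extends_root ::
    "real \<Rightarrow> real \<Rightarrow> (real \<Rightarrow> real set) \<Rightarrow> nat \<Rightarrow> (real \<Rightarrow> real) \<Rightarrow> (real \<Rightarrow> real) \<Rightarrow> bool" where
  "extends_root a b F n \<phi> fs \<longleftrightarrow>
     (let D = {a..b} - jumps {a..b} F; K = absorbing_interval a b F; g = (\<lambda>x. the_elem (F x)) in
        iterative_root_on K n F (\<lambda>x. {\<phi> x}) \<and> mono_on K \<phi> \<and>
        iterative_root_on D n F (\<lambda>x. {fs x}) \<and> continuous_on D fs \<and> strict_mono_on D fs \<and>
        (\<forall>x\<in>K. fs x = \<phi> x) \<and>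
        (\<forall>J\<in>jump_intervals a b F - {K}. \<exists>J1\<in>jump_intervals a b F.
           fs ` J \<subseteq> J1 \<and>
           (\<forall>x\<in>J. fs (g x) \<in> g ` J1 \<and> fs x = inv_into J1 g (fs (g x)))))"

end

theory Submission
  imports Defs
begin

text \<open>
  The value of \<open>F\<close> at a jump in \<open>(a, b)\<close> lies strictly below that jump, and \<open>F a = {a}\<close>, so a jump
  \<open>c\<close> with \<open>c \<in> F c\<close> must be \<open>b\<close>. Write \<open>F b = [p, b]\<close>. Upper semicontinuity and
  monotonicity give \<open>F x \<rightarrow> p\<close> as \<open>x\<close> tends to \<open>b\<close> from the left; let \<open>L\<close> be the left limit
  of \<open>fs\<close> at \<open>b\<close>. From \<open>F x = fs\<^sup>n x \<le> fs x\<close> one gets \<open>p \<le> L\<close>, so \<open>[L, b]\<close> meets the jumps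
  only in \<open>b\<close>. If \<open>L = b\<close>, then \<open>fs\<^sup>n x \<rightarrow> b\<close>, contradicting \<open>p < b\<close>. Hence \<open>L < b\<close>, and
  continuity at \<open>L\<close> yields \<open>fs\<^sup>n\<^sup>-\<^sup>1 L = p\<close>. Finally \<open>f\<close> maps \<open>[q, b]\<close> onto
  \<open>[fs q, L) \<union> [L, b] = [fs q, b]\<close>, so \<open>f\<^sup>n b = [fs\<^sup>n\<^sup>-\<^sup>1 L, b] = F b\<close>.
\<close>

section \<open>Iteration of single-valued maps\<close>

lemma funpow_image_subset: "h ` A \<subseteq> A \<Longrightarrow> x \<in> A \<Longrightarrow> (h ^^ k) x \<in> A"
  by (induction k) auto

lemma miter_single_valued:
  assumes "\<And>y. y \<in> A \<Longrightarrow> g y = {h y}" "h ` A \<subseteq> A" "x \<in> A"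
  shows "miter k g x = {(h ^^ k) x}"
  using assms funpow_image_subset[OF assms(2,3)]
  by (induction k) (auto simp: mcomp_def mimage_def)

text \<open>Meant for contraposition: an increasing root that rises weakly above the diagonal at
  \<open>x\<close> drags \<open>F x\<close> there too.\<close>

lemma funpow_ge_start:
  fixes h :: "'a::order \<Rightarrow> 'a"
  assumes "mono_on A h" "h ` A \<subseteq> A" "x \<in> A" "x \<le> h x"
  shows "x \<le> (h ^^ k) x"
proof (induction k)
  case (Suc k)
  have "h x \<le> h ((h ^^ k) x)"
    using mono_onD[OF assms(1) assms(3) funpow_image_subset[OF assms(2,3)] Suc] .
  with assms(4) show ?case by simp
qed simp

lemma funpow_decreasing:
  fixes h :: "'a::order \<Rightarrow> 'a"
  assumes "mono_on A h" "h ` A \<subseteq> A" "x \<in> A" "h x \<le> x" "j \<le> k"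
  shows "(h ^^ k) x \<le> (h ^^ j) x"
proof -
  have "(h ^^ Suc i) x \<le> (h ^^ i) x" for i
  proof (induction i)
    case (Suc i)
    have "h ((h ^^ Suc i) x) \<le> h ((h ^^ i) x)"
      by (rule mono_onD[OF assms(1) _ _ Suc]) (rule funpow_image_subset[OF assms(2,3)])+
    then show ?case by simp
  qed (use assms(4) in simp)
  then show ?thesis using assms(5) by (rule lift_Suc_antimono_le)
qed

lemma continuous_on_funpow:
  assumes "continuous_on A h" "h ` A \<subseteq> A"
  shows "continuous_on A (h ^^ k)"
proof (induction k)
  case (Suc k)
  have "(h ^^ k) ` A \<subseteq> A" using funpow_image_subset[OF assms(2)] by blast
  then have "continuous_on A (h \<circ> (h ^^ k))"
    using Suc assms(1) continuous_on_compose continuous_on_subset by blast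
  then show ?case by simp
qed (simp add: id_def continuous_on_id)

text \<open>The limit is the supremum of the values. It is never attained, because between any
  \<open>x\<close> and \<open>b\<close> there is a point with a still larger value.\<close>

lemma strict_mono_on_tendsto_left:
  fixes h :: "real \<Rightarrow> real"
  assumes "p < b" "strict_mono_on {p..<b} h" "\<And>x. x \<in> {p..<b} \<Longrightarrow> h x \<le> B"
  obtains L where "(h \<longlongrightarrow> L) (at_left b)" "\<And>x. x \<in> {p..<b} \<Longrightarrow> h x < L" "L \<le> B"
proof -
  define L where "L = Sup (h ` {p..<b})"
  have bdd: "bdd_above (h ` {p..<b})" using assms(3) by (auto intro!: bdd_aboveI[where M = B])
  have ne: "h ` {p..<b} \<noteq> {}" using assms(1) by auto
  have less: "h x < L" if x: "x \<in> {p..<b}" for x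
  proof -
    obtain y where y: "x < y" "y < b" using x dense by auto
    then have "h x < h y" using x by (intro strict_mono_onD[OF assms(2)]) auto
    also have "h y \<le> L" unfolding L_def using x y by (intro cSup_upper bdd) auto
    finally show ?thesis .
  qed
  have LB: "L \<le> B" unfolding L_def by (rule cSup_least[OF ne]) (use assms(3) in auto)
  have ev: "eventually (\<lambda>x. x \<in> {y<..<b}) (at_left b)" if "y < b" for y
    using that by (simp add: eventually_at_left_field) blast
  have "(h \<longlongrightarrow> L) (at_left b)"
  proof (rule increasing_tendsto)
    show "\<forall>\<^sub>F x in at_left b. h x \<le> L"
      using ev[OF assms(1)] by eventually_elim (use less in \<open>auto intro: less_imp_le\<close>)
    fix z assume "z < L"
    then obtain y where y: "y \<in> {p..<b}" "z < h y"
      unfolding L_def using less_cSup_iff[OF ne bdd] by auto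
    then have "y < b" by simp
    show "\<forall>\<^sub>F x in at_left b. z < h x"
      using ev[OF \<open>y < b\<close>]
    proof eventually_elim
      case (elim x)
      then have "h y < h x" using y by (intro strict_mono_onD[OF assms(2)]) auto
      with y show ?case by simp
    qed
  qed
  with less LB show thesis using that by blast
qed

text \<open>Values close to \<open>L\<close> are taken near \<open>b\<close>, so the intermediate
  value theorem fills everything below \<open>L\<close>; the right end stays open since
  \<open>L\<close> is not attained.\<close>

lemma image_Ico_left_limit:
  fixes h :: "real \<Rightarrow> real"
  assumes "p \<le> q" "q < b" "continuous_on {p..<b} h" "strict_mono_on {p..<b} h"
    and "(h \<longlongrightarrow> L) (at_left b)" "\<And>x. x \<in> {p..<b} \<Longrightarrow> h x < L"
  shows "h ` {q..<b} = {h q..<L}"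
proof (intro equalityI subsetI)
  fix y assume "y \<in> h ` {q..<b}"
  then obtain x where x: "x \<in> {q..<b}" "y = h x" by auto
  then have "h q \<le> h x"
    using assms(1,2) by (intro mono_onD[OF strict_mono_on_imp_mono_on[OF assms(4)]]) auto
  with x assms(1,6) show "y \<in> {h q..<L}" by auto
next
  fix y assume y: "y \<in> {h q..<L}"
  have "\<forall>\<^sub>F x in at_left b. y < h x" using order_tendstoD(1)[OF assms(5)] y by simp
  moreover have "\<forall>\<^sub>F x in at_left b. x \<in> {q<..<b}"
    using assms(2) by (simp add: eventually_at_left_field) blast
  ultimately have "\<forall>\<^sub>F x in at_left b. y < h x \<and> x \<in> {q<..<b}" by eventually_elim simp
  then obtain x where x: "y < h x" "q < x" "x < b"
    using eventually_happens trivial_limit_at_left_real by fastforce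
  have "continuous_on {q..x} h"
    using assms(1) x by (intro continuous_on_subset[OF assms(3)]) auto
  then obtain z where "q \<le> z" "z \<le> x" "h z = y"
    using IVT'[of h q y x] x y by auto
  then show "y \<in> h ` {q..<b}" using x by auto
qed

text \<open>The gap left by the jump closes: the image \<open>{h q..<L}\<close> of
  \<open>{q..<b}\<close> abuts the value \<open>{L..b}\<close> at \<open>b\<close>. Each step moves
  only the left endpoint, by \<open>h\<close>, so just the endpoints before the last one must lie in
  \<open>{p..<b}\<close>.\<close>

lemma miter_at_right_end:
  fixes h :: "real \<Rightarrow> real"
  assumes "continuous_on {p..<b} h" "strict_mono_on {p..<b} h"
    and "(h \<longlongrightarrow> L) (at_left b)" "\<And>x. x \<in> {p..<b} \<Longrightarrow> h x < L" "L \<le> b"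
    and "\<And>x. x \<in> {p..<b} \<Longrightarrow> g x = {h x}" "g b = {L..b}"
    and "\<And>j. j < k \<Longrightarrow> (h ^^ j) L \<in> {p..<b}"
  shows "miter (Suc k) g b = {(h ^^ k) L..b}"
  using assms(8)
proof (induction k)
  case 0
  then show ?case using assms(7) by (simp add: mcomp_def mimage_def)
next
  case (Suc k)
  define q where "q = (h ^^ k) L"
  have q: "p \<le> q" "q < b" using Suc.prems[of k] by (auto simp: q_def)
  have split: "{q..b} = insert b {q..<b}" using q by auto
  have "miter (Suc (Suc k)) g b = mimage g {q..b}"
    using Suc by (simp add: mcomp_def q_def)
  also have "\<dots> = {L..b} \<union> (\<Union>x\<in>{q..<b}. {h x})"
    unfolding split mimage_def using assms(6,7) q by auto
  also have "\<dots> = {L..b} \<union> h ` {q..<b}" by auto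
  also have "\<dots> = {L..b} \<union> {h q..<L}"
    using image_Ico_left_limit[OF q assms(1-4)] by simp
  also have "\<dots> = {h q..b}" using assms(4)[of q] assms(5) q by auto
  finally show ?case by (simp add: q_def)
qed

lemma has_extrema_atLeastAtMost: "l \<le> u \<Longrightarrow> has_extrema {l..u}"
  unfolding has_extrema_def by (metis atLeastAtMost_iff order_refl)

theorem theorem3p3:
  fixes a b c :: real and F :: "real \<Rightarrow> real set" and \<phi> fs :: "real \<Rightarrow> real" and n :: nat
  assumes "a < b"
    and "F \<in> intensity_one {a..b}"
    and "strictly_increasing_on {a..b} F"
    and "\<forall>x\<in>{a<..<b}. Sup (F x) < x"
    and "Sup (F b) \<le> b"
    and "c \<in> jumps {a..b} F"
    and "jumps {a..b} F \<inter> F c = {c}"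
    and "compact (F c)" and "is_interval (F c)"
    and "n \<ge> 1"
    and "extends_root a b F n \<phi> fs"
  defines "D \<equiv> ({a..b} - jumps {a..b} F) \<union> {c}"
    and "f \<equiv> (\<lambda>x. if x = c then {Lim (at_left c) fs..c} else {fs x})"
  shows "strictly_increasing_on D f \<and> usc_on D f \<and> iterative_root_on D n F f"
proof -
  define J where "J = jumps {a..b} F"
  define D0 where "D0 = {a..b} - J"
  have mf: "multifunction_on {a..b} F" and usc: "usc_on {a..b} F"
    using assms(2) by (auto simp: intensity_one_def strictly_monotone_usc_def)
  have inc: "Sup (F x) < Inf (F y)" if "x \<in> {a..b}" "y \<in> {a..b}" "x < y" for x y
    using assms(3) that by (auto simp: strictly_increasing_on_def)
  have sub: "F x \<subseteq> {a..b}" "F x \<noteq> {}" if "x \<in> {a..b}" for x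
    using mf that by (auto simp: multifunction_on_def)
  have bdd: "bdd_above (F x)" "bdd_below (F x)" if "x \<in> {a..b}" for x
    using sub(1)[OF that] by (meson bdd_above_Icc bdd_above_mono bdd_below_Icc bdd_below_mono)+
  have cJ: "c \<in> J" "c \<in> {a..b}" and cF: "c \<in> F c"
    using assms(6,7) by (auto simp: J_def jumps_def)
  have cb: "c = b"
  proof (rule ccontr)
    assume "c \<noteq> b"
    have "c \<le> Sup (F c)" using cF bdd[OF cJ(2)] by (simp add: cSup_upper)
    then have "c \<notin> {a<..<b}" using assms(4) by fastforce
    then have ca: "c = a" using cJ(2) \<open>c \<noteq> b\<close> by simp
    obtain u where u: "u \<in> F a" "u \<noteq> a"
      using cJ(1) ca by (auto simp: J_def jumps_def)
    have au: "a < u" "u \<le> b" using u sub(1)[of a] assms(1) by force+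
    \<comment> \<open>Monotonicity forces \<open>F y\<close> above \<open>u\<close>, hence above
      \<open>y\<close>, against the diagonal bound.\<close>
    obtain y where y: "a < y" "y < u" using au dense by blast
    have yI: "y \<in> {a..b}" and aI: "a \<in> {a..b}" using y au by auto
    have "u \<le> Sup (F a)" using u(1) bdd[OF aI] by (simp add: cSup_upper)
    also have "\<dots> < Inf (F y)" using inc aI yI y by simp
    also have "\<dots> \<le> Sup (F y)" using cInf_le_cSup[OF sub(2)[OF yI] bdd[OF yI]] .
    also have "\<dots> < y" using assms(4) y au by simp
    finally show False using y by simp
  qed

  \<comment> \<open>The value of \<open>F\<close> at \<open>b\<close>\<close>
  have aI: "a \<in> {a..b}" and bI: "b \<in> {a..b}" using assms(1) by auto
  define p where "p = Inf (F b)"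
  \<comment> \<open>Compactness makes the infimum a member; convexity then fills the interval up to
    \<open>b\<close>.\<close>
  have pF: "p \<in> F b" unfolding p_def
    using closed_contains_Inf[OF sub(2)[OF bI] bdd(2)[OF bI]] assms(8) cb compact_imp_closed by blast
  have Fb: "F b = {p..b}"
  proof (intro equalityI subsetI)
    fix x assume "x \<in> F b"
    then show "x \<in> {p..b}" using sub(1)[OF bI] bdd[OF bI] by (auto simp: p_def intro: cInf_lower)
  next
    fix x assume "x \<in> {p..b}"
    then show "x \<in> F b" using assms(9) pF cF cb
      by (auto intro: mem_is_interval_1_I)
  qed
  have "p \<noteq> b" using cJ(1) Fb unfolding cb by (auto simp: J_def jumps_def)
  moreover have "p \<le> b" using pF Fb by simp
  ultimately have pb: "p < b" by simp
  \<comment> \<open>Keeps \<open>{p..<b}\<close> inside the open interval where the diagonal bound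
    is available.\<close>
  have ap: "a < p"
  proof -
    obtain z where z: "z \<in> F a" using sub(2)[OF aI] by auto
    have "a \<le> z" using z sub(1)[OF aI] by auto
    also have "z \<le> Sup (F a)" using z bdd[OF aI] by (simp add: cSup_upper)
    also have "\<dots> < p" unfolding p_def using inc aI bI assms(1) by simp
    finally show ?thesis .
  qed
  have pD: "{p..<b} \<subseteq> D0"
    using assms(7) ap unfolding cb Fb by (force simp: D0_def J_def)
  have D0b: "x \<in> D0 \<Longrightarrow> x \<in> {a..b} \<and> x < b" for x
    using cJ(1) unfolding cb D0_def by (cases "x = b") auto

  \<comment> \<open>The root near \<open>b\<close> and its left limit\<close>
  have root: "iterative_root_on D0 n F (\<lambda>x. {fs x})" and cont: "continuous_on D0 fs"
    and smono: "strict_mono_on D0 fs"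
    using assms(11) by (auto simp: extends_root_def Let_def D0_def J_def)
  have mono: "mono_on D0 fs" using smono by (rule strict_mono_on_imp_mono_on)
  have img: "fs ` D0 \<subseteq> D0"
    using root by (auto simp: iterative_root_on_def multifunction_on_def)
  have Ffs: "F x = {(fs ^^ n) x}" if "x \<in> D0" for x
  proof -
    have "F x = miter n (\<lambda>x. {fs x}) x" using root that by (simp add: iterative_root_on_def)
    then show ?thesis using miter_single_valued[of D0 "\<lambda>x. {fs x}" fs x n] img that by simp
  qed
  have below: "fs x \<le> x" if "x \<in> {p..<b}" for x
  proof (rule ccontr)
    assume "\<not> fs x \<le> x"
    then have "x \<le> (fs ^^ n) x" using funpow_ge_start[OF mono img] that pD by auto
    then have "x \<le> Sup (F x)" using Ffs that pD by auto
    moreover have "Sup (F x) < x" using assms(4) that ap by simp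
    ultimately show False by simp
  qed
  have cont': "continuous_on {p..<b} fs" using cont pD by (rule continuous_on_subset)
  have smono': "strict_mono_on {p..<b} fs" using smono pD by (rule monotone_on_subset)
  obtain L where L: "(fs \<longlongrightarrow> L) (at_left b)" "\<And>x. x \<in> {p..<b} \<Longrightarrow> fs x < L" "L \<le> b"
  proof -
    have "fs x \<le> b" if "x \<in> {p..<b}" for x using below[OF that] that by auto
    then show thesis using strict_mono_on_tendsto_left[OF pb smono', of b] that by blast
  qed
  have evp: "\<forall>\<^sub>F x in at_left b. x \<in> {p..<b}"
    using pb by (simp add: eventually_at_left_field) (meson less_imp_le)
  \<comment> \<open>On \<open>D0\<close> this iterate is \<open>F\<close>: monotonicity bounds it by
    \<open>p\<close>, and upper semicontinuity at \<open>b\<close> keeps it above any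
    \<open>z < p\<close>.\<close>
  have lim_p: "((fs ^^ n) \<longlongrightarrow> p) (at_left b)"
  proof (rule increasing_tendsto)
    show "\<forall>\<^sub>F x in at_left b. (fs ^^ n) x \<le> p"
      using evp
    proof eventually_elim
      case (elim x)
      then have "Sup (F x) < p" using inc[of x b] ap bI by (simp add: p_def)
      then show ?case using Ffs elim pD by auto
    qed
    fix z assume "z < p"
    then have "open {z<..}" "F b \<subseteq> {z<..}" using Fb by auto
    then obtain U where U: "open U" "b \<in> U" "\<forall>x\<in>U \<inter> {a..b}. F x \<subseteq> {z<..}"
      using usc bI unfolding usc_on_def by meson
    have "\<forall>\<^sub>F x in at_left b. x \<in> U" by (rule topological_tendstoD[OF tendsto_ident_at U(1,2)])
    then show "\<forall>\<^sub>F x in at_left b. z < (fs ^^ n) x"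
      using evp
    proof eventually_elim
      case (elim x)
      then have "F x \<subseteq> {z<..}" using U(3) ap by simp
      then show ?case using Ffs elim pD by auto
    qed
  qed
  obtain m where m: "n = Suc m" using assms(10) by (cases n) auto
  have pL: "p \<le> L"
  proof (rule tendsto_le[OF trivial_limit_at_left_real L(1) lim_p])
    show "\<forall>\<^sub>F x in at_left b. (fs ^^ n) x \<le> fs x"
      using evp
    proof eventually_elim
      case (elim x)
      then show ?case
        using funpow_decreasing[OF mono img, of x 1 n] below pD assms(10) by auto
    qed
  qed
  have Lb: "L < b"
  proof (rule ccontr)
    assume "\<not> L < b"
    then have "L = b" using L(3) by simp
    \<comment> \<open>Strictness \<open>fs x < L = b\<close> makes \<open>fs\<close> preserve the
      approach from the left, so the limit can be iterated although \<open>b\<close> is outside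
      \<open>D0\<close>.\<close>
    have step: "filterlim fs (at_left b) (at_left b)"
      unfolding filterlim_at
    proof
      show "\<forall>\<^sub>F x in at_left b. fs x \<in> {..<b} \<and> fs x \<noteq> b"
        using evp by eventually_elim (use L(2) \<open>L = b\<close> in force)
    qed (use L(1) \<open>L = b\<close> in simp)
    have "filterlim (fs ^^ k) (at_left b) (at_left b)" for k
    proof (induction k)
      case (Suc k)
      show ?case using filterlim_compose[OF step Suc] by (simp add: comp_def)
    qed (simp add: filterlim_ident id_def)
    then have "((fs ^^ n) \<longlongrightarrow> b) (at_left b)" by (simp add: filterlim_at)
    then have "b = p" using lim_p tendsto_unique trivial_limit_at_left_real by blast
    then show False using pb by simp
  qed
  have LD: "L \<in> {p..<b}" "L \<in> D0" using pL Lb pD by auto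
  have "((\<lambda>x. (fs ^^ m) (fs x)) \<longlongrightarrow> (fs ^^ m) L) (at_left b)"
  proof (rule continuous_on_tendsto_compose[OF continuous_on_funpow[OF cont img] L(1) LD(2)])
    show "\<forall>\<^sub>F x in at_left b. fs x \<in> D0"
      using evp by eventually_elim (use pD img in blast)
  qed
  then have "((fs ^^ n) \<longlongrightarrow> (fs ^^ m) L) (at_left b)"
    by (simp add: m funpow_Suc_right comp_def del: funpow.simps)
  then have pm: "(fs ^^ m) L = p" using lim_p tendsto_unique trivial_limit_at_left_real by blast
  \<comment> \<open>The orbit of \<open>L\<close> decreases, so it stays between its
    \<open>m\<close>-th point \<open>p\<close> and \<open>L < b\<close>.\<close>
  have orbit: "(fs ^^ j) L \<in> {p..<b}" if "j < m" for j
    using funpow_decreasing[OF mono img LD(2) below[OF LD(1)], of j m]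
      funpow_decreasing[OF mono img LD(2) below[OF LD(1)], of 0 j] that pm Lb by simp
  have LimL: "Lim (at_left b) fs = L"
    using tendsto_Lim[OF trivial_limit_at_left_real L(1)] .
  have D: "D = insert b D0" unfolding D_def D0_def J_def cb by auto
  have fb: "f b = {L..b}" and f0: "\<And>x. x \<in> D0 \<Longrightarrow> f x = {fs x}"
    using D0b by (auto simp: f_def cb LimL)
  \<comment> \<open>Left of \<open>p\<close>, where the choice of \<open>L\<close> gives no bound,
    \<open>fs p\<close> serves as comparison.\<close>
  have fsL: "fs x < L" if "x \<in> D0" for x
  proof (cases "p \<le> x")
    case True
    then show ?thesis using L(2) D0b[OF that] by auto
  next
    case False
    then have "fs x \<le> fs p" using pb pD that by (intro mono_onD[OF mono]) auto
    also have "fs p < L" using L(2) pb by simp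
    finally show ?thesis .
  qed

  \<comment> \<open>Verification of the three properties of \<open>f\<close>\<close>
  have "strictly_increasing_on D f"
    unfolding strictly_increasing_on_def
  proof (intro conjI ballI impI)
    fix x assume "x \<in> D"
    then show "has_extrema (f x)"
      using has_extrema_atLeastAtMost[of L b] L(3) fb f0 has_extrema_atLeastAtMost[of "fs x" "fs x"]
      unfolding D by auto
  next
    fix x y assume xy: "x \<in> D" "y \<in> D" "x < y"
    have x: "x \<in> D0" using xy D0b[of y] unfolding D by auto
    show "Sup (f x) < Inf (f y)"
    proof (cases "y = b")
      case True
      then show ?thesis using fb f0[OF x] fsL[OF x] Lb by simp
    next
      case False
      then have "y \<in> D0" using xy unfolding D by simp
      then show ?thesis using strict_mono_onD[OF smono x _ xy(3)] f0 x by simp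
    qed
  qed
  moreover have "usc_on D f"
    unfolding usc_on_def
  proof (intro ballI allI impI)
    fix x0 V assume x0: "x0 \<in> D" and V: "open V \<and> f x0 \<subseteq> V"
    show "\<exists>U. open U \<and> x0 \<in> U \<and> (\<forall>x\<in>U \<inter> D. f x \<subseteq> V)"
    proof (cases "x0 = b")
      case True
      \<comment> \<open>As \<open>b\<close> is the largest point of \<open>D\<close>, the left limit
        alone controls a neighborhood.\<close>
      then have "L \<in> V" using V fb Lb by auto
      then have "\<forall>\<^sub>F x in at_left b. fs x \<in> V" using V topological_tendstoD[OF L(1)] by blast
      then obtain y where y: "y < b" "\<And>x. y < x \<Longrightarrow> x < b \<Longrightarrow> fs x \<in> V"
        by (auto simp: eventually_at_left_field)
      have "f x \<subseteq> V" if "x \<in> {y<..} \<inter> D" for x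
        using that y(2) f0 D0b V True unfolding D by auto
      then show ?thesis using True y(1) by (intro exI[of _ "{y<..}"]) auto
    next
      case False
      then have x: "x0 \<in> D0" using x0 unfolding D by simp
      then have "fs x0 \<in> V" using V f0 by auto
      then obtain U where U: "open U" "x0 \<in> U" "\<forall>y\<in>D0. y \<in> U \<longrightarrow> fs y \<in> V"
        using cont x V unfolding continuous_on_topological by meson
      \<comment> \<open>Cutting at \<open>b\<close> excludes the one point of \<open>D\<close> where
        \<open>f\<close> is not given by \<open>fs\<close>.\<close>
      have "f x \<subseteq> V" if "x \<in> (U \<inter> {..<b}) \<inter> D" for x
        using that U(3) f0 unfolding D by auto
      then show ?thesis using U D0b[OF x] by (intro exI[of _ "U \<inter> {..<b}"]) auto
    qed
  qed
  moreover have "iterative_root_on D n F f"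
    unfolding iterative_root_on_def
  proof (intro conjI ballI)
    have "{L..b} \<subseteq> insert b {p..<b}" using pL by auto
    then have "{L..b} \<subseteq> D" using pD unfolding D by blast
    then show "multifunction_on D f"
      using fb f0 img Lb unfolding multifunction_on_def D by auto
  next
    fix x assume "x \<in> D"
    then consider "x = b" | "x \<in> D0" unfolding D by auto
    then show "miter n f x = F x"
    proof cases
      case 1
      have "miter (Suc m) f b = {(fs ^^ m) L..b}"
      proof (rule miter_at_right_end[where h = fs and g = f and k = m, OF cont' smono' L _ fb orbit])
        show "f x = {fs x}" if "x \<in> {p..<b}" for x using f0 pD that by blast
      qed
      then show ?thesis using 1 m pm Fb by simp
    next
      case 2
      then show ?thesis using miter_single_valued[OF f0 img] Ffs by simp
    qed
  qed
  ultimately show ?thesis by simp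
qed

end
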